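(* Let $\mathfrak I_M=\{\langle v,v\rangle\}\cup\{\langle M^kv,M^kv\rangle:1\le k<d\}$, where $\langle a,b\rangle=\sum_ia_ib_i$. Then $\mathfrak I_M$ generates both the field $\mathbb C(\mathbb C^d\oplus\mathfrak{so}(d,\mathbb C))^{O_d(\mathbb C)}$ and the field $\mathbb R(\mathbb R^d\oplus\mathfrak{so}(d,\mathbb R))^{O_d(\mathbb R)}$, and separates orbits on $\mathbb C^d\oplus\mathfrak{so}(d,\mathbb C)$ (for $O_d(\mathbb C)$) and on $\mathbb R^d\oplus\mathfrak{so}(d,\mathbb R)$ (for $O_d(\mathbb R)$).
   Context: Fix $d\ge2$. Elements of $\mathbb K^d\oplus\mathfrak{so}(d,\mathbb K)$ ($\mathbb K=\mathbb R$ or $\mathbb C$) are pairs $(v,M)$, $v\in\mathbb K^d$, $M$ a skew-symmetric $d\times d$ matrix over $\mathbb K$; $O_d(\mathbb K)=\{A\in\mathbb K^{d\times d}:AA^\top=I\}$ acts by $A\cdot(v,M)=(Av,AMA^\top)$. $\mathbb K(X)^G$ denotes the field of $G$-invariant rational functions on $X$ with coefficients in $\mathbb K$; "generates" means generates as a field over $\mathbb K$. A set of invariants separates orbits if there is a non-empty Zariski-open subset on which two points lie in the same orbit if and only if all invariants in the set take equal values on them. *)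

theory Defs
  imports "HOL-Analysis.Analysis"
begin

(* Points of K^d (+) so(d,K): pairs (v, M); d = CARD('n). *)
type_synonym ('a,'n) pt = "('a ^ 'n) \<times> ('a ^ 'n ^ 'n)"

definition skew_pts :: "('a::field, 'n::finite) pt set" where
  "skew_pts = {(v, M). transpose M = - M}"

definition orth_group :: "('a::field ^ 'n ^ 'n) set" where
  "orth_group = {A. A ** transpose A = mat 1}"

definition act :: "'a::field ^ 'n ^ 'n \<Rightarrow> ('a, 'n) pt \<Rightarrow> ('a, 'n) pt" where
  "act A x = (A *v fst x, A ** snd x ** transpose A)"

(* the K-algebra of functions generated by a set C of functions *)
inductive_set polyfuns :: "('x \<Rightarrow> 'a::field) set \<Rightarrow> ('x \<Rightarrow> 'a) set" for C where
  gen: "f \<in> C \<Longrightarrow> f \<in> polyfuns C"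
| const: "(\<lambda>_. c) \<in> polyfuns C"
| add: "f \<in> polyfuns C \<Longrightarrow> g \<in> polyfuns C \<Longrightarrow> (\<lambda>x. f x + g x) \<in> polyfuns C"
| mult: "f \<in> polyfuns C \<Longrightarrow> g \<in> polyfuns C \<Longrightarrow> (\<lambda>x. f x * g x) \<in> polyfuns C"

(* coordinate functions on K^d x K^{d x d} *)
definition coord_funs :: "(('a::field, 'n::finite) pt \<Rightarrow> 'a) set" where
  "coord_funs = {(\<lambda>x. fst x $ i) | i. True} \<union> {(\<lambda>x. snd x $ i $ j) | i j. True}"

(* polynomial functions with coefficients in K *)
definition poly_funs :: "(('a::field, 'n::finite) pt \<Rightarrow> 'a) set" where
  "poly_funs = polyfuns coord_funs"

(* the symmetric bilinear form <a,b> = sum_i a_i b_i (no conjugation) *)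
definition bil :: "'a::field ^ 'n \<Rightarrow> 'a ^ 'n \<Rightarrow> 'a" where
  "bil a b = (\<Sum>i\<in>UNIV. a $ i * b $ i)"

(* I_k(v,M) = <M^k v, M^k v>; k = 0 gives <v,v> *)
definition inv_k :: "nat \<Rightarrow> ('a::field, 'n::finite) pt \<Rightarrow> 'a" where
  "inv_k k x = (let w = (((*v) (snd x)) ^^ k) (fst x) in bil w w)"

definition invariants_I :: "(('a::field, 'n::finite) pt \<Rightarrow> 'a) set" where
  "invariants_I = {inv_k k | k. k < CARD('n)}"

(* p/q (q not identically zero on the space) is an O_d-invariant rational function *)
definition rat_invariant :: "(('a::field, 'n::finite) pt \<Rightarrow> 'a) \<Rightarrow> (('a, 'n) pt \<Rightarrow> 'a) \<Rightarrow> bool" where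
  "rat_invariant p q \<longleftrightarrow> p \<in> poly_funs \<and> q \<in> poly_funs \<and> (\<exists>x\<in>skew_pts. q x \<noteq> 0) \<and>
     (\<forall>A\<in>orth_group. \<forall>x\<in>skew_pts. p (act A x) * q x = p x * q (act A x))"

(* p/q lies in the subfield of K(X) generated over K by the invariants I_M *)
definition in_generated_field :: "(('a::field, 'n::finite) pt \<Rightarrow> 'a) \<Rightarrow> (('a, 'n) pt \<Rightarrow> 'a) \<Rightarrow> bool" where
  "in_generated_field p q \<longleftrightarrow> (\<exists>P\<in>polyfuns invariants_I. \<exists>Q\<in>polyfuns invariants_I.
     (\<exists>x\<in>skew_pts. Q x \<noteq> 0) \<and> (\<forall>x\<in>skew_pts. p x * Q x = q x * P x))"

definition generates_invariant_field :: "('a::field \<times> 'n::finite) itself \<Rightarrow> bool" where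
  "generates_invariant_field _ \<longleftrightarrow>
     (\<forall>f\<in>(invariants_I :: (('a, 'n) pt \<Rightarrow> 'a) set). rat_invariant f (\<lambda>_. 1)) \<and>
     (\<forall>p q :: ('a, 'n) pt \<Rightarrow> 'a. rat_invariant p q \<longrightarrow> in_generated_field p q)"

(* Zariski-open subsets of the space X = K^d (+) so(d,K) *)
definition zariski_open :: "('a::field, 'n::finite) pt set \<Rightarrow> bool" where
  "zariski_open U \<longleftrightarrow> (\<exists>F\<subseteq>poly_funs. U = skew_pts - {x\<in>skew_pts. \<forall>f\<in>F. f x = 0})"

definition separates_orbits :: "('a::field \<times> 'n::finite) itself \<Rightarrow> bool" where
  "separates_orbits _ \<longleftrightarrow> (\<exists>U :: ('a, 'n) pt set. zariski_open U \<and> U \<noteq> {} \<and>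
     (\<forall>x\<in>U. \<forall>y\<in>U. (\<exists>A\<in>orth_group. act A x = y) \<longleftrightarrow> (\<forall>f\<in>invariants_I. f x = f y)))"

end

theory Submission
  imports Defs "HOL-Computational_Algebra.Polynomial"
begin

text \<open>Write \<open>w\<^sub>k = M\<^sup>k v\<close>. Since \<open>M\<close> is skew, \<open>\<langle>w\<^sub>i, w\<^sub>j\<rangle> = (-1)\<^sup>i \<langle>v, w\<^sub>i\<^sub>+\<^sub>j\<rangle>\<close>,
  which is \<open>0\<close> for odd \<open>i + j\<close> and \<open>\<plusminus>\<langle>M\<^sup>m v, M\<^sup>m v\<rangle>\<close> for \<open>i + j = 2m\<close>. Hence the inner
  products of \<open>w\<^sub>0, \<dots>, w\<^sub>d\<^sub>-\<^sub>1\<close> with each other and with \<open>M w\<^sub>0, \<dots>, M w\<^sub>d\<^sub>-\<^sub>1\<close> are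
  polynomials in the invariants, and so are, after division by Gram--Schmidt norms, those of
  the orthogonalised vectors \<open>y\<^sub>0, \<dots>, y\<^sub>d\<^sub>-\<^sub>1\<close>. This works on the Zariski-open set where
  all \<open>\<langle>y\<^sub>k, y\<^sub>k\<rangle>\<close> are nonzero, which is nonempty by an explicit tridiagonal example.
  If \<open>e\<^sub>k\<^sup>2 = \<langle>y\<^sub>k, y\<^sub>k\<rangle>\<close> (square roots exist over \<open>\<complex>\<close>, and over \<open>\<real>\<close> because the
  form is positive), the matrix with rows \<open>y\<^sub>k / e\<^sub>k\<close> is orthogonal and moves \<open>(v, M)\<close> to a
  normal form whose entries are rational functions of the invariants times monomials in the
  \<open>e\<^sub>k\<close>.

  Equal invariants give equal normal forms, hence the same orbit. For an invariant rational
  function \<open>p / q\<close>, the values of \<open>p\<close> and \<open>q\<close> at the normal forms are multilinear in the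
  \<open>e\<^sub>k\<close> with coefficients rational in the invariants. Changing the signs of the \<open>e\<^sub>k\<close> is
  again an orthogonal move, so corresponding coefficients are in the ratio \<open>p / q\<close>, and any
  coefficient of \<open>q\<close> that is not identically zero exhibits \<open>p / q\<close> as a rational function of
  the invariants.\<close>

section \<open>Polynomial functions and Zariski density\<close>

lemma polyfuns_sum:
  "finite S \<Longrightarrow> (\<And>i. i \<in> S \<Longrightarrow> f i \<in> polyfuns C) \<Longrightarrow> (\<lambda>x. \<Sum>i\<in>S. f i x) \<in> polyfuns C"
  by (induction S rule: finite_induct) (auto intro: polyfuns.intros)

lemma polyfuns_subset:
  assumes "C \<subseteq> polyfuns D"
  shows "polyfuns C \<subseteq> polyfuns D"
proof
  fix f assume "f \<in> polyfuns C"
  then show "f \<in> polyfuns D"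
    by (induction rule: polyfuns.induct) (use assms in \<open>auto intro: polyfuns.intros\<close>)
qed

lemma polyfuns_eq_if_generators_eq:
  "P \<in> polyfuns C \<Longrightarrow> (\<And>f. f \<in> C \<Longrightarrow> f x = f y) \<Longrightarrow> P x = P y"
  by (induction P rule: polyfuns.induct) auto

lemma coord_poly_funs:
  "(\<lambda>x. fst x $ i) \<in> poly_funs" "(\<lambda>x. snd x $ i $ j) \<in> poly_funs"
  unfolding poly_funs_def coord_funs_def by (auto intro: polyfuns.gen)

lemma transpose_eq_uminus_iff: "transpose M = - M \<longleftrightarrow> (\<forall>i j. M $ j $ i = - M $ i $ j)"
  by (simp add: vec_eq_iff transpose_def)

lemma skew_ptsD: "x \<in> skew_pts \<Longrightarrow> transpose (snd x) = - snd x"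
  unfolding skew_pts_def by auto

definition line_pt :: "('a::field, 'n::finite) pt \<Rightarrow> ('a, 'n) pt \<Rightarrow> 'a \<Rightarrow> ('a, 'n) pt" where
  "line_pt x y t = ((\<chi> i. fst x $ i + t * (fst y $ i - fst x $ i)),
     (\<chi> i j. snd x $ i $ j + t * (snd y $ i $ j - snd x $ i $ j)))"

lemma line_pt_0 [simp]: "line_pt x y 0 = x"
  and line_pt_1 [simp]: "line_pt x y 1 = y"
  by (simp_all add: line_pt_def vec_eq_iff)

lemma line_pt_skew_pts:
  assumes "x \<in> skew_pts" "y \<in> skew_pts"
  shows "line_pt x y t \<in> skew_pts"
proof -
  have "snd (line_pt x y t) $ j $ i = - snd (line_pt x y t) $ i $ j" for i j
  proof -
    have "snd x $ j $ i = - snd x $ i $ j" "snd y $ j $ i = - snd y $ i $ j"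
      using skew_ptsD[OF assms(1)] skew_ptsD[OF assms(2)] unfolding transpose_eq_uminus_iff by blast+
    then show ?thesis
      by (simp add: line_pt_def algebra_simps)
  qed
  then have "transpose (snd (line_pt x y t)) = - snd (line_pt x y t)"
    unfolding transpose_eq_uminus_iff by blast
  then show ?thesis
    unfolding skew_pts_def by (simp add: case_prod_beta)
qed

lemma poly_funs_on_line:
  assumes "f \<in> poly_funs"
  shows "\<exists>P. \<forall>t. f (line_pt x y t) = poly P t"
  using assms unfolding poly_funs_def
proof (induction rule: polyfuns.induct)
  case (gen f)
  then consider i where "f = (\<lambda>x. fst x $ i)" | i j where "f = (\<lambda>x. snd x $ i $ j)"
    unfolding coord_funs_def by blast
  then show ?case
  proof cases
    case 1
    show ?thesis
      by (rule exI[of _ "[:fst x $ i, fst y $ i - fst x $ i:]"]) (simp add: 1 line_pt_def algebra_simps)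
  next
    case 2
    show ?thesis
      by (rule exI[of _ "[:snd x $ i $ j, snd y $ i $ j - snd x $ i $ j:]"])
         (simp add: 2 line_pt_def algebra_simps)
  qed
next
  case (const c)
  show ?case
    by (rule exI[of _ "[:c:]"]) simp
next
  case (add f g)
  then obtain P Q where "\<forall>t. f (line_pt x y t) = poly P t" "\<forall>t. g (line_pt x y t) = poly Q t"
    by blast
  then show ?case
    by (intro exI[of _ "P + Q"]) simp
next
  case (mult f g)
  then obtain P Q where "\<forall>t. f (line_pt x y t) = poly P t" "\<forall>t. g (line_pt x y t) = poly Q t"
    by blast
  then show ?case
    by (intro exI[of _ "P * Q"]) simp
qed

lemma poly_funs_common_nonzero:
  fixes f g :: "('a::field_char_0, 'n::finite) pt \<Rightarrow> 'a"
  assumes "f \<in> poly_funs" "g \<in> poly_funs" "x \<in> skew_pts" "y \<in> skew_pts" "f x \<noteq> 0" "g y \<noteq> 0"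
  obtains z where "z \<in> skew_pts" "f z \<noteq> 0" "g z \<noteq> 0"
proof -
  obtain P Q where P: "\<forall>t. f (line_pt x y t) = poly P t" and Q: "\<forall>t. g (line_pt x y t) = poly Q t"
    using poly_funs_on_line[OF assms(1)] poly_funs_on_line[OF assms(2)] by blast
  have "P * Q \<noteq> 0"
    using P[rule_format, of 0] Q[rule_format, of 1] assms(5,6) by auto
  then have "finite {t. poly (P * Q) t = 0}"
    by (rule poly_roots_finite)
  then obtain t where "poly (P * Q) t \<noteq> 0"
    using ex_new_if_finite[OF infinite_UNIV_char_0] by blast
  then show ?thesis
    using that[of "line_pt x y t"] line_pt_skew_pts[OF assms(3,4)] P Q by auto
qed

section \<open>Multilinear polynomials on sign vectors\<close>

lemma prod_mult_prod_sym_diff: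
  assumes "finite S" "finite T"
  shows "(\<Prod>i\<in>S. e i) * (\<Prod>i\<in>T. e i) = (\<Prod>i\<in>(S - T) \<union> (T - S). e i) * (\<Prod>i\<in>S \<inter> T. e i * e i)"
proof -
  have "(\<Prod>i\<in>S. e i) = (\<Prod>i\<in>S \<inter> T. e i) * (\<Prod>i\<in>S - T. e i)"
    by (rule prod.Int_Diff[OF assms(1)])
  moreover have "(\<Prod>i\<in>T. e i) = (\<Prod>i\<in>S \<inter> T. e i) * (\<Prod>i\<in>T - S. e i)"
    using prod.Int_Diff[OF assms(2), of e S] by (simp add: Int_commute)
  moreover have "(\<Prod>i\<in>(S - T) \<union> (T - S). e i) = (\<Prod>i\<in>S - T. e i) * (\<Prod>i\<in>T - S. e i)"
    using assms by (intro prod.union_disjoint) auto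
  ultimately show ?thesis
    by (simp add: prod.distrib mult_ac)
qed

lemma sum_Pow_insert_monomials:
  fixes h :: "'i set \<Rightarrow> 'a::comm_semiring_1"
  assumes "finite I" "a \<notin> I"
  shows "(\<Sum>S\<in>Pow (insert a I). h S * (\<Prod>i\<in>S. e i))
    = (\<Sum>S\<in>Pow I. (h S + e a * h (insert a S)) * (\<Prod>i\<in>S. e i))"
proof -
  have "(\<Sum>S\<in>Pow (insert a I). h S * (\<Prod>i\<in>S. e i))
      = (\<Sum>S\<in>Pow I. h S * (\<Prod>i\<in>S. e i)) + (\<Sum>S\<in>insert a ` Pow I. h S * (\<Prod>i\<in>S. e i))"
    unfolding Pow_insert using assms by (subst sum.union_disjoint) auto
  also have "(\<Sum>S\<in>insert a ` Pow I. h S * (\<Prod>i\<in>S. e i))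
      = (\<Sum>S\<in>Pow I. h (insert a S) * (\<Prod>i\<in>insert a S. e i))"
    using assms by (subst sum.reindex) (auto simp: inj_on_def)
  also have "\<dots> = (\<Sum>S\<in>Pow I. e a * h (insert a S) * (\<Prod>i\<in>S. e i))"
  proof (rule sum.cong[OF refl])
    fix S assume "S \<in> Pow I"
    then have "finite S" "a \<notin> S"
      using assms finite_subset by auto
    then show "h (insert a S) * (\<Prod>i\<in>insert a S. e i) = e a * h (insert a S) * (\<Prod>i\<in>S. e i)"
      by (simp add: mult_ac)
  qed
  finally show ?thesis
    by (simp add: distrib_right sum.distrib)
qed

lemma monomial_coeffs_zero_if_zero_on_signs:
  fixes h :: "'i set \<Rightarrow> 'a::field_char_0"
  assumes "finite I" "\<forall>i\<in>I. c i \<noteq> 0"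
    and "\<forall>e. (\<forall>i\<in>I. e i = c i \<or> e i = - c i) \<longrightarrow> (\<Sum>S\<in>Pow I. h S * (\<Prod>i\<in>S. e i)) = 0"
  shows "\<forall>S\<subseteq>I. h S = 0"
  using assms
proof (induction I arbitrary: h rule: finite_induct)
  case empty
  then show ?case by auto
next
  case (insert a I)
  have signed: "\<forall>S\<subseteq>I. h S + s * c a * h (insert a S) = 0" if s: "s = 1 \<or> s = -1" for s :: 'a
  proof (rule insert.IH)
    show "\<forall>i\<in>I. c i \<noteq> 0"
      using insert.prems(1) by blast
    show "\<forall>e. (\<forall>i\<in>I. e i = c i \<or> e i = - c i) \<longrightarrow>
        (\<Sum>S\<in>Pow I. (h S + s * c a * h (insert a S)) * (\<Prod>i\<in>S. e i)) = 0"
    proof (intro allI impI)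
      fix e assume e: "\<forall>i\<in>I. e i = c i \<or> e i = - c i"
      let ?e = "e(a := s * c a)"
      have "(\<Sum>S\<in>Pow I. (h S + s * c a * h (insert a S)) * (\<Prod>i\<in>S. e i))
          = (\<Sum>S\<in>Pow (insert a I). h S * (\<Prod>i\<in>S. ?e i))"
        unfolding sum_Pow_insert_monomials[OF insert.hyps]
        using insert.hyps(2) by (intro sum.cong refl) (auto intro!: prod.cong)
      also have "\<dots> = 0"
        using insert.prems(2) e s by auto
      finally show "(\<Sum>S\<in>Pow I. (h S + s * c a * h (insert a S)) * (\<Prod>i\<in>S. e i)) = 0" .
    qed
  qed
  have zero: "h S = 0 \<and> h (insert a S) = 0" if "S \<subseteq> I" for S
  proof -
    have plus: "h S + c a * h (insert a S) = 0" and minus: "h S - c a * h (insert a S) = 0"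
      using signed[of 1] signed[of "-1"] that by auto
    then have "2 * (c a * h (insert a S)) = 0"
      by (simp add: algebra_simps)
    then have "h (insert a S) = 0"
      using insert.prems(1) by simp
    then show ?thesis
      using plus by simp
  qed
  show ?case
  proof (intro allI impI)
    fix S assume S: "S \<subseteq> insert a I"
    show "h S = 0"
    proof (cases "a \<in> S")
      case True
      then have "S = insert a (S - {a})" "S - {a} \<subseteq> I"
        using S by auto
      then show ?thesis using zero by metis
    next
      case False
      then show ?thesis using S zero by auto
    qed
  qed
qed

section \<open>The bilinear form and the orthogonal group\<close>

lemma bil_commute: "bil a b = bil b a"
  unfolding bil_def by (simp add: mult.commute)

lemma bil_diff_left: "bil (a - b) c = bil a c - bil b c"
  unfolding bil_def by (simp add: left_diff_distrib sum_subtractf)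

lemma bil_scale_left: "bil (r *s a) b = r * bil a b"
  unfolding bil_def by (simp add: sum_distrib_left mult.assoc)

lemma bil_scale_right: "bil a (r *s b) = r * bil a b"
  unfolding bil_def by (simp add: sum_distrib_left mult_ac)

lemma bil_sum_left: "bil (\<Sum>i\<in>S. f i) b = (\<Sum>i\<in>S. bil (f i) b)"
  unfolding bil_def by (induction S rule: infinite_finite_induct) (auto simp: sum.distrib distrib_right)

lemma bil_sum_right: "bil b (\<Sum>i\<in>S. f i) = (\<Sum>i\<in>S. bil b (f i))"
  using bil_sum_left[of f S b] by (simp add: bil_commute)

lemma bil_matrix_vector_left: "bil (A *v a) b = bil a (transpose A *v b)"
  unfolding bil_def matrix_vector_mult_def transpose_def
  by (simp add: sum_distrib_right sum_distrib_left mult_ac) (rule sum.swap)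

lemma bil_skew_left:
  assumes "transpose M = - M"
  shows "bil (M *v a) b = - bil a (M *v b)"
  unfolding bil_matrix_vector_left assms
  by (simp add: bil_def matrix_vector_mult_def sum_negf)

lemma bil_skew_self:
  fixes M :: "'a::field_char_0 ^ 'n::finite ^ 'n"
  assumes "transpose M = - M"
  shows "bil a (M *v a) = 0"
  using bil_skew_left[OF assms, of a a] by (simp add: bil_commute)

lemma bil_axis: "bil w (axis i 1) = w $ i"
  unfolding bil_def axis_def by (simp add: if_distrib[where f = "\<lambda>c. _ * c"] cong: if_cong)

lemma matrix_vector_mult_nth_bil: "(A *v v) $ i = bil (A $ i) v"
  by (simp add: matrix_vector_mult_def bil_def)

lemma matrix_mult_transpose_nth_bil: "(A ** M ** transpose B) $ i $ j = bil (A $ i) (M *v B $ j)"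
  unfolding bil_def matrix_matrix_mult_def matrix_vector_mult_def transpose_def
  by (simp add: sum_distrib_left sum_distrib_right mult_ac) (rule sum.swap)

lemma orth_group_transpose_mult: "A \<in> orth_group \<Longrightarrow> transpose A ** A = mat 1"
  unfolding orth_group_def using matrix_left_right_inverse by blast

lemma orth_group_transpose: "A \<in> orth_group \<Longrightarrow> transpose A \<in> orth_group"
  using orth_group_transpose_mult[of A] unfolding orth_group_def by simp

lemma orth_group_mult: "A \<in> orth_group \<Longrightarrow> B \<in> orth_group \<Longrightarrow> B ** A \<in> orth_group"
  unfolding orth_group_def
  by (simp add: matrix_transpose_mul matrix_mul_assoc) (metis matrix_mul_assoc matrix_mul_rid)

lemma act_act: "act B (act A x) = act (B ** A) x"
  unfolding act_def by (simp add: matrix_vector_mul_assoc matrix_transpose_mul matrix_mul_assoc)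

lemma act_mat_1 [simp]: "act (mat 1) x = x"
  unfolding act_def by simp

lemma bil_orth_group: "A \<in> orth_group \<Longrightarrow> bil (A *v a) (A *v b) = bil a b"
  by (simp add: bil_matrix_vector_left matrix_vector_mul_assoc orth_group_transpose_mult)

section \<open>Krylov vectors\<close>

definition krylov :: "('a::field, 'n::finite) pt \<Rightarrow> nat \<Rightarrow> 'a ^ 'n" where
  "krylov x k = ((*v) (snd x) ^^ k) (fst x)"

lemma krylov_0 [simp]: "krylov x 0 = fst x"
  and krylov_Suc: "krylov x (Suc k) = snd x *v krylov x k"
  by (simp_all add: krylov_def)

lemma inv_k_krylov: "inv_k k x = bil (krylov x k) (krylov x k)"
  by (simp add: inv_k_def krylov_def Let_def)

lemma krylov_coord_poly_funs: "(\<lambda>x. krylov x k $ i) \<in> poly_funs"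
proof (induction k arbitrary: i)
  case 0
  show ?case by (simp add: coord_poly_funs)
next
  case (Suc k)
  show ?case
    unfolding krylov_Suc matrix_vector_mult_def vec_lambda_beta poly_funs_def
    using Suc coord_poly_funs unfolding poly_funs_def
    by (intro polyfuns_sum polyfuns.mult) auto
qed

lemma inv_k_poly_funs: "inv_k k \<in> poly_funs"
proof -
  have "(\<lambda>x. bil (krylov x k) (krylov x k)) \<in> poly_funs"
    unfolding bil_def poly_funs_def using krylov_coord_poly_funs unfolding poly_funs_def
    by (intro polyfuns_sum polyfuns.mult) auto
  then show ?thesis by (simp add: inv_k_krylov [abs_def])
qed

lemma polyfuns_invariants_I_subset: "polyfuns invariants_I \<subseteq> poly_funs"
  unfolding poly_funs_def
  by (rule polyfuns_subset) (use inv_k_poly_funs in \<open>auto simp: invariants_I_def poly_funs_def\<close>)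

lemma inv_k_polyfuns_invariants_I:
  "k < CARD('n) \<Longrightarrow> (inv_k k :: ('a::field, 'n::finite) pt \<Rightarrow> 'a) \<in> polyfuns invariants_I"
  unfolding invariants_I_def by (rule polyfuns.gen) blast

lemma krylov_act: "A \<in> orth_group \<Longrightarrow> krylov (act A x) k = A *v krylov x k"
proof (induction k)
  case 0
  then show ?case by (simp add: act_def)
next
  case (Suc k)
  have "A ** snd x ** transpose A ** A = A ** snd x"
    by (metis matrix_mul_assoc matrix_mul_rid orth_group_transpose_mult[OF Suc.prems])
  then show ?case
    using Suc by (simp add: krylov_Suc act_def matrix_vector_mul_assoc)
qed

lemma inv_k_act: "A \<in> orth_group \<Longrightarrow> inv_k k (act A x) = inv_k k x"
  by (simp add: inv_k_krylov krylov_act bil_orth_group)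

lemma funpow_matrix_vector_sum:
  fixes M :: "'a::field ^ 'n::finite ^ 'n"
  shows "((*v) M ^^ s) (\<Sum>j\<in>S. c j *s w j) = (\<Sum>j\<in>S. c j *s ((*v) M ^^ s) (w j))"
  by (induction s) (simp_all add: vec.sum vec.scale)

lemma funpow_krylov: "((*v) (snd x) ^^ s) (krylov x j) = krylov x (s + j)"
  by (simp add: krylov_def funpow_add)

definition krylov_gram :: "nat \<Rightarrow> nat \<Rightarrow> ('a::field, 'n::finite) pt \<Rightarrow> 'a" where
  "krylov_gram i j x =
     (if even (i + j) then (-1) ^ i * (-1) ^ ((i + j) div 2) * inv_k ((i + j) div 2) x else 0)"

lemma bil_krylov_shift:
  assumes "x \<in> skew_pts"
  shows "bil (krylov x i) (krylov x j) = (-1) ^ i * bil (fst x) (krylov x (i + j))"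
proof (induction i arbitrary: j)
  case 0
  then show ?case by simp
next
  case (Suc i)
  have "bil (krylov x (Suc i)) (krylov x j) = - bil (krylov x i) (krylov x (Suc j))"
    by (simp add: krylov_Suc bil_skew_left[OF skew_ptsD[OF assms]])
  then show ?case
    using Suc[of "Suc j"] by simp
qed

lemma bil_krylov_krylov:
  fixes x :: "('a::field_char_0, 'n::finite) pt"
  assumes "x \<in> skew_pts"
  shows "bil (krylov x i) (krylov x j) = krylov_gram i j x"
proof (cases "even (i + j)")
  case True
  then obtain m where m: "i + j = 2 * m"
    by (metis evenE)
  have "inv_k m x = (-1) ^ m * bil (fst x) (krylov x (2 * m))"
    using bil_krylov_shift[OF assms, of m m] by (simp add: inv_k_krylov mult_2)
  then have "bil (fst x) (krylov x (2 * m)) = (-1) ^ m * inv_k m x"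
    by (metis minus_one_mult_self mult.assoc mult_1)
  then show ?thesis
    using bil_krylov_shift[OF assms, of i j] m True by (simp add: krylov_gram_def)
next
  case False
  then obtain m where m: "i + j = 2 * m + 1"
    by (metis oddE)
  have "bil (krylov x m) (krylov x (Suc m)) = 0"
    by (simp add: krylov_Suc bil_skew_self[OF skew_ptsD[OF assms]])
  then have "bil (fst x) (krylov x (i + j)) = 0"
    using bil_krylov_shift[OF assms, of m "Suc m"] m by (simp add: mult_2)
  then show ?thesis
    using bil_krylov_shift[OF assms, of i j] False by (simp add: krylov_gram_def)
qed

lemma krylov_gram_polyfuns:
  "(i + j) div 2 < CARD('n) \<Longrightarrow> (krylov_gram i j :: ('a::field, 'n::finite) pt \<Rightarrow> 'a) \<in> polyfuns invariants_I"
  unfolding krylov_gram_def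
  by (cases "even (i + j)")
     (auto intro!: polyfuns.mult polyfuns.const inv_k_polyfuns_invariants_I simp: polyfuns.const)

section \<open>Functions rational in the invariants\<close>

definition rat_in_invariants :: "('a::field, 'n::finite) pt set \<Rightarrow> (('a, 'n) pt \<Rightarrow> 'a) \<Rightarrow> bool" where
  "rat_in_invariants U h \<longleftrightarrow>
     (\<exists>P\<in>polyfuns invariants_I. \<exists>Q\<in>polyfuns invariants_I. \<forall>x\<in>U. Q x \<noteq> 0 \<and> h x = P x / Q x)"

lemma rat_in_invariantsI:
  assumes "P \<in> polyfuns invariants_I" "Q \<in> polyfuns invariants_I"
    "\<And>x. x \<in> U \<Longrightarrow> Q x \<noteq> 0" "\<And>x. x \<in> U \<Longrightarrow> h x = P x / Q x"
  shows "rat_in_invariants U h"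
  unfolding rat_in_invariants_def using assms by blast

lemma rat_in_invariantsE:
  assumes "rat_in_invariants U h"
  obtains P Q where "P \<in> polyfuns invariants_I" "Q \<in> polyfuns invariants_I"
    "\<And>x. x \<in> U \<Longrightarrow> Q x \<noteq> 0" "\<And>x. x \<in> U \<Longrightarrow> h x = P x / Q x"
  using assms unfolding rat_in_invariants_def by blast

lemma rat_in_invariants_polyfuns: "P \<in> polyfuns invariants_I \<Longrightarrow> rat_in_invariants U P"
  by (rule rat_in_invariantsI[where Q = "\<lambda>_. 1"]) (auto intro: polyfuns.const)

lemma rat_in_invariants_const: "rat_in_invariants U (\<lambda>_. c)"
  by (intro rat_in_invariants_polyfuns polyfuns.const)

lemma rat_in_invariants_subset: "rat_in_invariants U h \<Longrightarrow> V \<subseteq> U \<Longrightarrow> rat_in_invariants V h"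
  unfolding rat_in_invariants_def by blast

lemma rat_in_invariants_cong:
  "rat_in_invariants U h \<Longrightarrow> (\<And>x. x \<in> U \<Longrightarrow> h x = h' x) \<Longrightarrow> rat_in_invariants U h'"
  unfolding rat_in_invariants_def by metis

lemma rat_in_invariants_add:
  assumes "rat_in_invariants U f" "rat_in_invariants U g"
  shows "rat_in_invariants U (\<lambda>x. f x + g x)"
proof -
  obtain P Q where "P \<in> polyfuns invariants_I" "Q \<in> polyfuns invariants_I"
    "\<And>x. x \<in> U \<Longrightarrow> Q x \<noteq> 0" "\<And>x. x \<in> U \<Longrightarrow> f x = P x / Q x"
    using assms(1) by (elim rat_in_invariantsE) blast
  moreover obtain P' Q' where "P' \<in> polyfuns invariants_I" "Q' \<in> polyfuns invariants_I"
    "\<And>x. x \<in> U \<Longrightarrow> Q' x \<noteq> 0" "\<And>x. x \<in> U \<Longrightarrow> g x = P' x / Q' x"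
    using assms(2) by (elim rat_in_invariantsE) blast
  ultimately show ?thesis
    by (intro rat_in_invariantsI[of "\<lambda>x. P x * Q' x + P' x * Q x" "\<lambda>x. Q x * Q' x"])
       (auto intro: polyfuns.intros simp: field_simps)
qed

lemma rat_in_invariants_mult:
  assumes "rat_in_invariants U f" "rat_in_invariants U g"
  shows "rat_in_invariants U (\<lambda>x. f x * g x)"
proof -
  obtain P Q where "P \<in> polyfuns invariants_I" "Q \<in> polyfuns invariants_I"
    "\<And>x. x \<in> U \<Longrightarrow> Q x \<noteq> 0" "\<And>x. x \<in> U \<Longrightarrow> f x = P x / Q x"
    using assms(1) by (elim rat_in_invariantsE) blast
  moreover obtain P' Q' where "P' \<in> polyfuns invariants_I" "Q' \<in> polyfuns invariants_I"
    "\<And>x. x \<in> U \<Longrightarrow> Q' x \<noteq> 0" "\<And>x. x \<in> U \<Longrightarrow> g x = P' x / Q' x"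
    using assms(2) by (elim rat_in_invariantsE) blast
  ultimately show ?thesis
    by (intro rat_in_invariantsI[of "\<lambda>x. P x * P' x" "\<lambda>x. Q x * Q' x"])
       (auto intro: polyfuns.intros)
qed

lemma rat_in_invariants_divide:
  assumes "rat_in_invariants U f" "rat_in_invariants U g" "\<And>x. x \<in> U \<Longrightarrow> g x \<noteq> 0"
  shows "rat_in_invariants U (\<lambda>x. f x / g x)"
proof -
  obtain P Q where "P \<in> polyfuns invariants_I" "Q \<in> polyfuns invariants_I"
    "\<And>x. x \<in> U \<Longrightarrow> Q x \<noteq> 0" "\<And>x. x \<in> U \<Longrightarrow> f x = P x / Q x"
    using assms(1) by (elim rat_in_invariantsE) blast
  moreover obtain P' Q' where "P' \<in> polyfuns invariants_I" "Q' \<in> polyfuns invariants_I"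
    "\<And>x. x \<in> U \<Longrightarrow> Q' x \<noteq> 0" "\<And>x. x \<in> U \<Longrightarrow> g x = P' x / Q' x"
    using assms(2) by (elim rat_in_invariantsE) blast
  ultimately show ?thesis
    using assms(3) by (intro rat_in_invariantsI[of "\<lambda>x. P x * Q' x" "\<lambda>x. Q x * P' x"])
       (auto intro: polyfuns.intros)
qed

lemma rat_in_invariants_sum:
  "finite S \<Longrightarrow> (\<And>i. i \<in> S \<Longrightarrow> rat_in_invariants U (f i)) \<Longrightarrow> rat_in_invariants U (\<lambda>x. \<Sum>i\<in>S. f i x)"
  by (induction S rule: finite_induct) (auto intro: rat_in_invariants_const rat_in_invariants_add)

lemma rat_in_invariants_prod:
  "finite S \<Longrightarrow> (\<And>i. i \<in> S \<Longrightarrow> rat_in_invariants U (f i)) \<Longrightarrow> rat_in_invariants U (\<lambda>x. \<Prod>i\<in>S. f i x)"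
  by (induction S rule: finite_induct) (auto intro: rat_in_invariants_const rat_in_invariants_mult)

lemma rat_in_invariants_eq:
  assumes "rat_in_invariants U h" "x \<in> U" "y \<in> U" "\<forall>f\<in>invariants_I. f x = f y"
  shows "h x = h y"
proof -
  obtain P Q where "P \<in> polyfuns invariants_I" "Q \<in> polyfuns invariants_I"
    "\<And>x. x \<in> U \<Longrightarrow> h x = P x / Q x"
    using assms(1) by (elim rat_in_invariantsE) blast
  then show ?thesis
    using polyfuns_eq_if_generators_eq[of _ invariants_I x y] assms(2-4) by metis
qed

definition krylov_comb :: "('a::field, 'n::finite) pt set \<Rightarrow> (('a, 'n) pt \<Rightarrow> 'a ^ 'n) \<Rightarrow> bool" where
  "krylov_comb U z \<longleftrightarrow> (\<exists>r. (\<forall>j. rat_in_invariants U (r j)) \<and>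
     (\<forall>x\<in>U. z x = (\<Sum>j<CARD('n). r j x *s krylov x j)))"

lemma krylov_comb_subset: "krylov_comb U z \<Longrightarrow> V \<subseteq> U \<Longrightarrow> krylov_comb V z"
  unfolding krylov_comb_def using rat_in_invariants_subset by blast

lemma krylov_comb_krylov:
  fixes U :: "('a::field, 'n::finite) pt set"
  assumes "j < CARD('n)"
  shows "krylov_comb U (\<lambda>x. krylov x j)"
  unfolding krylov_comb_def
  by (rule exI[of _ "\<lambda>i x. if i = j then 1 else 0"])
     (use assms in \<open>auto simp: rat_in_invariants_const if_distrib[of "\<lambda>c. c *s _"] cong: if_cong\<close>)

lemma krylov_comb_zero: "krylov_comb U (\<lambda>x. 0)"
  unfolding krylov_comb_def by (rule exI[of _ "\<lambda>j x. 0"]) (auto simp: rat_in_invariants_const)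

lemma krylov_comb_add:
  fixes U :: "('a::field, 'n::finite) pt set"
  assumes "krylov_comb U a" "krylov_comb U b"
  shows "krylov_comb U (\<lambda>x. a x + b x)"
proof -
  obtain r r' where "\<forall>j. rat_in_invariants U (r j)" "\<forall>x\<in>U. a x = (\<Sum>j<CARD('n). r j x *s krylov x j)"
    "\<forall>j. rat_in_invariants U (r' j)" "\<forall>x\<in>U. b x = (\<Sum>j<CARD('n). r' j x *s krylov x j)"
    using assms unfolding krylov_comb_def by meson
  then show ?thesis
    unfolding krylov_comb_def
    by (intro exI[of _ "\<lambda>j x. r j x + r' j x"])
       (simp add: rat_in_invariants_add sum.distrib)
qed

lemma krylov_comb_scale:
  fixes U :: "('a::field, 'n::finite) pt set"
  assumes "rat_in_invariants U c" "krylov_comb U a"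
  shows "krylov_comb U (\<lambda>x. c x *s a x)"
proof -
  obtain r where "\<forall>j. rat_in_invariants U (r j)" "\<forall>x\<in>U. a x = (\<Sum>j<CARD('n). r j x *s krylov x j)"
    using assms(2) unfolding krylov_comb_def by meson
  then show ?thesis
    unfolding krylov_comb_def using assms(1)
    by (intro exI[of _ "\<lambda>j x. c x * r j x"]) (simp add: rat_in_invariants_mult vec.scale_sum_right)
qed

lemma krylov_comb_diff: "krylov_comb U a \<Longrightarrow> krylov_comb U b \<Longrightarrow> krylov_comb U (\<lambda>x. a x - b x)"
  using krylov_comb_add[of U a "\<lambda>x. (-1) *s b x"] krylov_comb_scale[OF rat_in_invariants_const, of U b "-1"]
  by (simp add: vector_sneg_minus1[symmetric])

lemma krylov_comb_sum:
  "finite S \<Longrightarrow> (\<And>i. i \<in> S \<Longrightarrow> krylov_comb U (f i)) \<Longrightarrow> krylov_comb U (\<lambda>x. \<Sum>i\<in>S. f i x)"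
  by (induction S rule: finite_induct) (auto intro: krylov_comb_zero krylov_comb_add)

text \<open>The Gram entries involved are \<open>\<langle>w\<^sub>i, w\<^sub>j\<^sub>+\<^sub>s\<rangle>\<close> with \<open>i, j < d\<close>; they are among the given
  invariants \<open>I\<^sub>m\<close>, \<open>m < d\<close>, exactly when \<open>s \<le> 1\<close>.\<close>

lemma rat_in_invariants_bil_krylov_comb:
  fixes U :: "('a::field_char_0, 'n::finite) pt set"
  assumes "U \<subseteq> skew_pts" "krylov_comb U a" "krylov_comb U b" "s \<le> 1"
  shows "rat_in_invariants U (\<lambda>x. bil (a x) (((*v) (snd x) ^^ s) (b x)))"
proof -
  obtain r r' where r: "\<forall>j. rat_in_invariants U (r j)" "\<forall>x\<in>U. a x = (\<Sum>j<CARD('n). r j x *s krylov x j)"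
    and r': "\<forall>j. rat_in_invariants U (r' j)" "\<forall>x\<in>U. b x = (\<Sum>j<CARD('n). r' j x *s krylov x j)"
    using assms(2,3) unfolding krylov_comb_def by meson
  have "rat_in_invariants U (krylov_gram i (s + j))" if "i < CARD('n)" "j < CARD('n)" for i j
    using that assms(4) by (intro rat_in_invariants_polyfuns krylov_gram_polyfuns) linarith
  then have "rat_in_invariants U
      (\<lambda>x. \<Sum>i<CARD('n). \<Sum>j<CARD('n). r i x * (r' j x * krylov_gram i (s + j) x))"
    using r(1) r'(1) by (intro rat_in_invariants_sum rat_in_invariants_mult) auto
  then show ?thesis
  proof (rule rat_in_invariants_cong)
    fix x assume x: "x \<in> U"
    have "bil (a x) (((*v) (snd x) ^^ s) (b x))
        = bil (\<Sum>i<CARD('n). r i x *s krylov x i) (\<Sum>j<CARD('n). r' j x *s krylov x (s + j))"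
      using x r(2) r'(2) by (simp add: funpow_matrix_vector_sum funpow_krylov)
    also have "\<dots> = (\<Sum>i<CARD('n). r i x * bil (krylov x i) (\<Sum>j<CARD('n). r' j x *s krylov x (s + j)))"
      by (simp add: bil_sum_left bil_scale_left)
    also have "\<dots> = (\<Sum>i<CARD('n). \<Sum>j<CARD('n). r i x * (r' j x * bil (krylov x i) (krylov x (s + j))))"
      by (simp add: bil_sum_right bil_scale_right sum_distrib_left)
    finally show "(\<Sum>i<CARD('n). \<Sum>j<CARD('n). r i x * (r' j x * krylov_gram i (s + j) x))
        = bil (a x) (((*v) (snd x) ^^ s) (b x))"
      using x assms(1) by (auto simp: bil_krylov_krylov)
  qed
qed

corollary rat_in_invariants_bil:
  fixes U :: "('a::field_char_0, 'n::finite) pt set"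
  assumes "U \<subseteq> skew_pts" "krylov_comb U a" "krylov_comb U b"
  shows "rat_in_invariants U (\<lambda>x. bil (a x) (b x))"
  using rat_in_invariants_bil_krylov_comb[OF assms, of 0] by simp

corollary rat_in_invariants_bil_skew:
  fixes U :: "('a::field_char_0, 'n::finite) pt set"
  assumes "U \<subseteq> skew_pts" "krylov_comb U a" "krylov_comb U b"
  shows "rat_in_invariants U (\<lambda>x. bil (a x) (snd x *v b x))"
  using rat_in_invariants_bil_krylov_comb[OF assms, of 1] by simp

section \<open>Gram--Schmidt orthogonalisation of the Krylov vectors\<close>

text \<open>Gram--Schmidt without normalisation. A vanishing norm makes the corresponding division
  return the junk value \<open>0\<close>; this only happens outside \<open>gs_generic\<close>.\<close>

fun gs_list :: "('a::field, 'n::finite) pt \<Rightarrow> nat \<Rightarrow> ('a ^ 'n) list" where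
  "gs_list x 0 = []"
| "gs_list x (Suc k) = gs_list x k @
     [krylov x k - (\<Sum>l<k. (bil (krylov x k) (gs_list x k ! l) / bil (gs_list x k ! l) (gs_list x k ! l))
        *s gs_list x k ! l)]"

definition gs :: "('a::field, 'n::finite) pt \<Rightarrow> nat \<Rightarrow> 'a ^ 'n" where
  "gs x k = gs_list x (Suc k) ! k"

definition gs_norm :: "('a::field, 'n::finite) pt \<Rightarrow> nat \<Rightarrow> 'a" where
  "gs_norm x k = bil (gs x k) (gs x k)"

lemma length_gs_list [simp]: "length (gs_list x k) = k"
  by (induction k) auto

lemma gs_list_nth: "l < k \<Longrightarrow> gs_list x k ! l = gs x l"
proof (induction k)
  case 0
  then show ?case by simp
next
  case (Suc k)
  show ?case
  proof (cases "l = k")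
    case True
    then show ?thesis by (simp add: gs_def)
  next
    case False
    then show ?thesis using Suc by (simp add: nth_append)
  qed
qed

lemma gs_rec: "gs x k = krylov x k - (\<Sum>l<k. (bil (krylov x k) (gs x l) / gs_norm x l) *s gs x l)"
proof -
  have "gs x k = krylov x k - (\<Sum>l<k. (bil (krylov x k) (gs_list x k ! l)
      / bil (gs_list x k ! l) (gs_list x k ! l)) *s gs_list x k ! l)"
    by (simp add: gs_def nth_append)
  also have "\<dots> = krylov x k - (\<Sum>l<k. (bil (krylov x k) (gs x l) / gs_norm x l) *s gs x l)"
    by (intro arg_cong2[where f = minus] refl sum.cong) (simp_all add: gs_list_nth gs_norm_def)
  finally show ?thesis .
qed

lemma bil_gs_gs:
  assumes "\<forall>j<k. gs_norm x j \<noteq> 0" "l < k"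
  shows "bil (gs x k) (gs x l) = 0"
  using assms
proof (induction k arbitrary: l rule: less_induct)
  case (less k)
  have orth: "bil (gs x j) (gs x l) = 0" if "j < k" "j \<noteq> l" for j
  proof (cases "l < j")
    case True
    then show ?thesis using less that by auto
  next
    case False
    then show ?thesis
      using less.IH[of l j] less.prems that by (simp add: bil_commute)
  qed
  have "bil (gs x k) (gs x l)
      = bil (krylov x k) (gs x l) - (\<Sum>j<k. (bil (krylov x k) (gs x j) / gs_norm x j) * bil (gs x j) (gs x l))"
    by (subst gs_rec) (simp add: bil_diff_left bil_sum_left bil_scale_left)
  also have "(\<Sum>j<k. (bil (krylov x k) (gs x j) / gs_norm x j) * bil (gs x j) (gs x l))
      = bil (krylov x k) (gs x l)"
    using less.prems by (subst sum.remove[of _ l]) (auto intro!: sum.neutral simp: orth gs_norm_def)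
  finally show ?case by simp
qed

definition gs_generic :: "nat \<Rightarrow> ('a::field, 'n::finite) pt set" where
  "gs_generic k = {x \<in> skew_pts. \<forall>l<k. gs_norm x l \<noteq> 0}"

lemma gs_generic_subset_skew_pts: "gs_generic k \<subseteq> skew_pts"
  unfolding gs_generic_def by auto

lemma gs_generic_antimono: "k \<le> k' \<Longrightarrow> gs_generic k' \<subseteq> gs_generic k"
  unfolding gs_generic_def by auto

lemma krylov_comb_gs:
  "k < CARD('n) \<Longrightarrow> krylov_comb (gs_generic k :: ('a::field_char_0, 'n::finite) pt set) (\<lambda>x. gs x k)"
proof (induction k rule: less_induct)
  case (less k)
  have gs_prev: "krylov_comb (gs_generic k :: ('a, 'n) pt set) (\<lambda>x. gs x l)" if "l < k" for l
    using less that krylov_comb_subset gs_generic_antimono[of l k] by auto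
  have "krylov_comb (gs_generic k :: ('a, 'n) pt set)
      (\<lambda>x. krylov x k - (\<Sum>l<k. (bil (krylov x k) (gs x l) / gs_norm x l) *s gs x l))"
    unfolding gs_norm_def
    by (intro krylov_comb_diff krylov_comb_krylov krylov_comb_sum krylov_comb_scale
          rat_in_invariants_divide rat_in_invariants_bil gs_generic_subset_skew_pts gs_prev less.prems)
       (auto simp: gs_generic_def gs_norm_def)
  then show ?case
    by (simp only: gs_rec[symmetric])
qed

lemma gs_generic_eq_nonzero_set:
  "k \<le> CARD('n) \<Longrightarrow>
     \<exists>G\<in>polyfuns invariants_I. (gs_generic k :: ('a::field_char_0, 'n::finite) pt set) = {x\<in>skew_pts. G x \<noteq> 0}"
proof (induction k)
  case 0
  show ?case
    by (rule bexI[of _ "\<lambda>_. 1"]) (auto simp: gs_generic_def intro: polyfuns.const)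
next
  case (Suc k)
  then obtain G where G: "G \<in> polyfuns invariants_I" "(gs_generic k :: ('a, 'n) pt set) = {x\<in>skew_pts. G x \<noteq> 0}"
    by auto
  have "rat_in_invariants (gs_generic k :: ('a, 'n) pt set) (\<lambda>x. gs_norm x k)"
    unfolding gs_norm_def using Suc.prems
    by (intro rat_in_invariants_bil gs_generic_subset_skew_pts krylov_comb_gs) auto
  then obtain P Q where P: "P \<in> polyfuns invariants_I"
    and PQ: "\<And>x :: ('a, 'n) pt. x \<in> gs_generic k \<Longrightarrow> Q x \<noteq> 0 \<and> gs_norm x k = P x / Q x"
    by (elim rat_in_invariantsE) blast
  have "(gs_generic (Suc k) :: ('a, 'n) pt set) = {x \<in> gs_generic k. gs_norm x k \<noteq> 0}"
    unfolding gs_generic_def using less_Suc_eq by auto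
  also have "\<dots> = {x\<in>skew_pts. G x * P x \<noteq> 0}"
    using PQ G(2) by auto
  finally show ?case
    using G(1) P by (intro bexI[of _ "\<lambda>x. G x * P x"] polyfuns.mult)
qed

definition generic_pts :: "('a::field, 'n::finite) pt set" where
  "generic_pts = gs_generic CARD('n)"

lemma generic_pts_subset_skew_pts: "generic_pts \<subseteq> skew_pts"
  unfolding generic_pts_def by (rule gs_generic_subset_skew_pts)

lemma gs_norm_generic_nonzero:
  "x \<in> (generic_pts :: ('a::field, 'n::finite) pt set) \<Longrightarrow> l < CARD('n) \<Longrightarrow> gs_norm x l \<noteq> 0"
  unfolding generic_pts_def gs_generic_def by auto

lemma generic_pts_eq_nonzero_set:
  "\<exists>G\<in>polyfuns invariants_I. (generic_pts :: ('a::field_char_0, 'n::finite) pt set) = {x\<in>skew_pts. G x \<noteq> 0}"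
  unfolding generic_pts_def by (rule gs_generic_eq_nonzero_set) simp

lemma zariski_open_generic_pts: "zariski_open (generic_pts :: ('a::field_char_0, 'n::finite) pt set)"
proof -
  obtain G where "G \<in> polyfuns invariants_I" "(generic_pts :: ('a, 'n) pt set) = {x\<in>skew_pts. G x \<noteq> 0}"
    using generic_pts_eq_nonzero_set by blast
  then show ?thesis
    unfolding zariski_open_def using polyfuns_invariants_I_subset by (intro exI[of _ "{G}"]) auto
qed

lemma bil_gs_gs_generic:
  assumes "x \<in> (generic_pts :: ('a::field, 'n::finite) pt set)" "k < CARD('n)" "l < CARD('n)" "k \<noteq> l"
  shows "bil (gs x k) (gs x l) = 0"
proof -
  have "\<forall>j<max k l. gs_norm x j \<noteq> 0"
    using assms(2,3) gs_norm_generic_nonzero[OF assms(1)] by auto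
  then show ?thesis
    using assms(4) bil_gs_gs[of "max k l" x "min k l"] by (cases "k < l") (auto simp: bil_commute)
qed

lemma krylov_comb_gs_generic:
  assumes "k < CARD('n)"
  shows "krylov_comb (generic_pts :: ('a::field_char_0, 'n::finite) pt set) (\<lambda>x. gs x k)"
proof -
  have "(generic_pts :: ('a, 'n) pt set) \<subseteq> gs_generic k"
    unfolding generic_pts_def using assms by (intro gs_generic_antimono) simp
  then show ?thesis
    by (rule krylov_comb_subset[OF krylov_comb_gs[OF assms]])
qed

lemma krylov_comb_generic_fst: "krylov_comb generic_pts fst"
  using krylov_comb_krylov[of 0 generic_pts] by simp

lemma rat_in_invariants_gs_norm:
  "k < CARD('n) \<Longrightarrow> rat_in_invariants (generic_pts :: ('a::field_char_0, 'n::finite) pt set) (\<lambda>x. gs_norm x k)"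
  unfolding gs_norm_def
  by (intro rat_in_invariants_bil generic_pts_subset_skew_pts krylov_comb_gs_generic)

section \<open>A generic point\<close>

definition idx :: "'n::finite \<Rightarrow> nat" where
  "idx = (SOME h. bij_betw h UNIV {..<CARD('n)})"

definition idx_inv :: "nat \<Rightarrow> 'n::finite" where
  "idx_inv = inv_into UNIV idx"

lemma bij_idx: "bij_betw (idx :: 'n::finite \<Rightarrow> nat) UNIV {..<CARD('n)}"
proof -
  have "\<exists>h. bij_betw h (UNIV :: 'n set) {..<CARD('n)}"
    using ex_bij_betw_finite_nat[of "UNIV :: 'n set"] by (simp add: atLeast0LessThan)
  then show ?thesis
    unfolding idx_def by (rule someI_ex)
qed

lemma idx_less: "idx (i :: 'n::finite) < CARD('n)"
  using bij_idx[where 'n = 'n] unfolding bij_betw_def by auto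

lemma inj_idx: "inj (idx :: 'n::finite \<Rightarrow> nat)"
  using bij_idx unfolding bij_betw_def by blast

lemma idx_eq_iff: "k < CARD('n) \<Longrightarrow> idx (a :: 'n::finite) = k \<longleftrightarrow> a = idx_inv k"
  unfolding idx_inv_def using bij_idx[where 'n = 'n] inj_idx[where 'n = 'n]
  by (auto simp: bij_betw_inv_into_right)

lemma idx_idx_inv: "k < CARD('n) \<Longrightarrow> idx (idx_inv k :: 'n::finite) = k"
  by (simp add: idx_eq_iff)

lemma idx_inv_idx: "idx_inv (idx a) = (a :: 'n::finite)"
  using idx_eq_iff[OF idx_less[of a], of a] by simp

lemma sum_if_idx_eq:
  "k < CARD('n) \<Longrightarrow> (\<Sum>b\<in>(UNIV :: 'n::finite set). if idx b = k then c else 0) = c"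
  by (simp add: idx_eq_iff)

text \<open>The point \<open>(e\<^sub>0, M)\<close> with \<open>M\<close> the skew tridiagonal shift: \<open>M\<^sup>k e\<^sub>0\<close> is \<open>e\<^sub>k\<close> plus
  a combination of \<open>e\<^sub>0, \<dots>, e\<^sub>k\<^sub>-\<^sub>1\<close>, so Gram--Schmidt returns the standard basis.\<close>

definition witness :: "('a::field, 'n::finite) pt" where
  "witness = ((\<chi> a. if idx a = 0 then 1 else 0),
     (\<chi> a b. if idx a = idx b + 1 then 1 else if idx b = idx a + 1 then -1 else 0))"

lemma witness_skew_pts: "witness \<in> skew_pts"
  unfolding skew_pts_def witness_def by (auto simp: vec_eq_iff transpose_def)

lemma krylov_witness:
  "k \<le> idx a \<Longrightarrow> krylov (witness :: ('a::field, 'n::finite) pt) k $ a = (if idx a = k then 1 else 0)"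
proof (induction k arbitrary: a)
  case 0
  then show ?case by (simp add: witness_def)
next
  case (Suc k)
  have "snd witness $ a $ b * krylov (witness :: ('a, 'n) pt) k $ b
      = (if idx a = Suc k \<and> idx b = k then 1 else 0)" for b
    using Suc.IH[of b] Suc.prems by (auto simp: witness_def)
  then have "krylov (witness :: ('a, 'n) pt) (Suc k) $ a
      = (\<Sum>b\<in>(UNIV :: 'n set). if idx a = Suc k \<and> idx b = k then 1 else 0)"
    by (simp add: krylov_Suc matrix_vector_mult_def)
  also have "\<dots> = (if idx a = Suc k then 1 else 0)"
    using idx_less[of a] by (cases "idx a = Suc k") (simp_all add: sum_if_idx_eq)
  finally show ?case .
qed

lemma gs_witness:
  "k < CARD('n) \<Longrightarrow> gs (witness :: ('a::field, 'n::finite) pt) k = axis (idx_inv k) 1"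
proof (induction k rule: less_induct)
  case (less k)
  let ?x = "witness :: ('a, 'n) pt"
  have "gs ?x k = krylov ?x k - (\<Sum>l<k. (krylov ?x k $ idx_inv l) *s axis (idx_inv l) 1)"
    using less by (subst gs_rec) (intro arg_cong2[where f = minus] refl sum.cong;
        simp add: gs_norm_def bil_axis)
  also have "\<dots> = axis (idx_inv k) 1"
  proof (rule vec_eq_iff[THEN iffD2, rule_format])
    fix a :: 'n
    have "(\<Sum>l<k. (krylov ?x k $ idx_inv l) *s axis (idx_inv l) 1) $ a
        = (\<Sum>l<k. if l = idx a then krylov ?x k $ a else 0)"
      unfolding sum_component
    proof (rule sum.cong[OF refl])
      fix l assume "l \<in> {..<k}"
      then have "idx a = l \<longleftrightarrow> a = idx_inv l"
        using less.prems by (intro idx_eq_iff) auto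
      then show "((krylov ?x k $ idx_inv l) *s axis (idx_inv l) 1) $ a
          = (if l = idx a then krylov ?x k $ a else 0)"
        by (auto simp: axis_def)
    qed
    then show "(krylov ?x k - (\<Sum>l<k. (krylov ?x k $ idx_inv l) *s axis (idx_inv l) 1)) $ a
        = axis (idx_inv k) 1 $ a"
      using krylov_witness[of k a] less.prems by (auto simp: axis_def idx_idx_inv idx_inv_idx)
  qed
  finally show ?case .
qed

lemma witness_generic_pts: "(witness :: ('a::field, 'n::finite) pt) \<in> generic_pts"
proof -
  have "gs_norm (witness :: ('a, 'n) pt) l = 1" if "l < CARD('n)" for l
    using that by (simp add: gs_norm_def gs_witness bil_axis)
  then show ?thesis
    unfolding generic_pts_def gs_generic_def using witness_skew_pts by auto
qed

lemma nonzero_at_generic_pt: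
  fixes q :: "('a::field_char_0, 'n::finite) pt \<Rightarrow> 'a"
  assumes "q \<in> poly_funs" "x \<in> skew_pts" "q x \<noteq> 0"
  obtains x0 where "x0 \<in> generic_pts" "q x0 \<noteq> 0"
proof -
  obtain G where G: "G \<in> polyfuns invariants_I" "(generic_pts :: ('a, 'n) pt set) = {x\<in>skew_pts. G x \<noteq> 0}"
    using generic_pts_eq_nonzero_set by blast
  have "G witness \<noteq> 0"
    using witness_generic_pts G(2) by blast
  moreover have "G \<in> poly_funs"
    using G(1) polyfuns_invariants_I_subset by blast
  ultimately obtain z where "z \<in> skew_pts" "q z \<noteq> 0" "G z \<noteq> 0"
    using poly_funs_common_nonzero[OF assms(1) _ assms(2) witness_skew_pts assms(3)] by blast
  then show ?thesis
    using that G(2) by blast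
qed

section \<open>The normal form\<close>

definition sqrt_norms :: "('a::field, 'n::finite) pt \<Rightarrow> ('n \<Rightarrow> 'a) \<Rightarrow> bool" where
  "sqrt_norms x e \<longleftrightarrow> (\<forall>i. e i ^ 2 = gs_norm x (idx i))"

lemma sqrt_norms_nonzero:
  assumes "x \<in> generic_pts" "sqrt_norms x e"
  shows "e i \<noteq> 0"
proof
  assume "e i = 0"
  then have "gs_norm x (idx i) = 0"
    using assms(2) unfolding sqrt_norms_def by (metis zero_power2)
  then show False
    using gs_norm_generic_nonzero[OF assms(1) idx_less] by blast
qed

lemma inverse_sqrt_norms:
  assumes "x \<in> generic_pts" "sqrt_norms x e"
  shows "inverse (e i) = e i / gs_norm x (idx i)"
proof -
  have "gs_norm x (idx i) = e i * e i"
    using assms(2) unfolding sqrt_norms_def by (simp add: power2_eq_square)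
  then show ?thesis
    using sqrt_norms_nonzero[OF assms, of i] by (simp add: field_simps)
qed

lemma sqrt_norms_exists:
  assumes "\<forall>w :: 'a ^ 'n. \<exists>c. c ^ 2 = bil w w"
  shows "\<exists>e. sqrt_norms (x :: ('a::field, 'n::finite) pt) e"
proof -
  have "\<forall>i. \<exists>c. c ^ 2 = gs_norm x (idx i)"
    using assms by (simp add: gs_norm_def)
  then show ?thesis
    unfolding sqrt_norms_def by (rule choice)
qed

lemma sqrt_norms_sign_change:
  "sqrt_norms x c \<Longrightarrow> (\<forall>i. e i = c i \<or> e i = - c i) \<Longrightarrow> sqrt_norms x e"
  unfolding sqrt_norms_def by (metis power2_minus)

definition frame :: "('a::field, 'n::finite) pt \<Rightarrow> ('n \<Rightarrow> 'a) \<Rightarrow> 'a ^ 'n ^ 'n" where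
  "frame x e = (\<chi> i. inverse (e i) *s gs x (idx i))"

definition nf_vec :: "('a::field, 'n::finite) pt \<Rightarrow> 'n \<Rightarrow> 'a" where
  "nf_vec x i = bil (gs x (idx i)) (fst x) / gs_norm x (idx i)"

definition nf_mat :: "('a::field, 'n::finite) pt \<Rightarrow> 'n \<Rightarrow> 'n \<Rightarrow> 'a" where
  "nf_mat x i j = bil (gs x (idx i)) (snd x *v gs x (idx j)) / (gs_norm x (idx i) * gs_norm x (idx j))"

text \<open>The coordinates of \<open>x\<close> in the frame \<open>y\<^sub>i / e\<^sub>i\<close>, rewritten with
  \<open>1 / e\<^sub>i = e\<^sub>i / \<langle>y\<^sub>i, y\<^sub>i\<rangle>\<close>.\<close>

definition normal_form :: "('a::field, 'n::finite) pt \<Rightarrow> ('n \<Rightarrow> 'a) \<Rightarrow> ('a, 'n) pt" where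
  "normal_form x e = ((\<chi> i. nf_vec x i * e i), (\<chi> i j. nf_mat x i j * (e i * e j)))"

lemma frame_orth_group:
  assumes "x \<in> generic_pts" "sqrt_norms x e"
  shows "frame x e \<in> orth_group"
proof -
  have entry: "(frame x e ** transpose (frame x e)) $ i $ j
      = inverse (e i) * inverse (e j) * bil (gs x (idx i)) (gs x (idx j))" for i j
    using matrix_mult_transpose_nth_bil[of "frame x e" "mat 1" "frame x e" i j]
    by (simp add: frame_def bil_scale_left bil_scale_right)
  have "(frame x e ** transpose (frame x e)) $ i $ j = mat 1 $ i $ j" for i j
  proof (cases "i = j")
    case True
    then show ?thesis
      using entry[of i i] assms(2) sqrt_norms_nonzero[OF assms, of i]
        gs_norm_generic_nonzero[OF assms(1) idx_less[of i]]
      by (simp add: sqrt_norms_def gs_norm_def power2_eq_square mat_def field_simps)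
  next
    case False
    then have "bil (gs x (idx i)) (gs x (idx j)) = 0"
      using assms(1) idx_less inj_idx by (intro bil_gs_gs_generic) (auto dest: injD)
    then show ?thesis
      using False entry[of i j] by (simp add: mat_def)
  qed
  then show ?thesis
    unfolding orth_group_def by (simp add: vec_eq_iff)
qed

lemma act_frame:
  assumes "x \<in> generic_pts" "sqrt_norms x e"
  shows "act (frame x e) x = normal_form x e"
  using inverse_sqrt_norms[OF assms]
  by (simp add: act_def normal_form_def vec_eq_iff matrix_vector_mult_nth_bil matrix_mult_transpose_nth_bil
      frame_def bil_scale_left bil_scale_right vec.scale nf_vec_def nf_mat_def mult_ac)

lemma rat_in_invariants_nf_vec:
  "rat_in_invariants (generic_pts :: ('a::field_char_0, 'n::finite) pt set) (\<lambda>x. nf_vec x i)"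
proof -
  have "rat_in_invariants (generic_pts :: ('a, 'n) pt set) (\<lambda>x. bil (gs x (idx i)) (fst x))"
    by (intro rat_in_invariants_bil generic_pts_subset_skew_pts krylov_comb_gs_generic
        krylov_comb_generic_fst idx_less)
  then show ?thesis
    unfolding nf_vec_def
    by (rule rat_in_invariants_divide[OF _ rat_in_invariants_gs_norm[OF idx_less]])
       (simp add: gs_norm_generic_nonzero idx_less)
qed

lemma rat_in_invariants_nf_mat:
  "rat_in_invariants (generic_pts :: ('a::field_char_0, 'n::finite) pt set) (\<lambda>x. nf_mat x i j)"
proof -
  have "rat_in_invariants (generic_pts :: ('a, 'n) pt set) (\<lambda>x. bil (gs x (idx i)) (snd x *v gs x (idx j)))"
    by (intro rat_in_invariants_bil_skew generic_pts_subset_skew_pts krylov_comb_gs_generic idx_less)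
  moreover have "rat_in_invariants (generic_pts :: ('a, 'n) pt set)
      (\<lambda>x. gs_norm x (idx i) * gs_norm x (idx j))"
    by (intro rat_in_invariants_mult rat_in_invariants_gs_norm idx_less)
  ultimately show ?thesis
    unfolding nf_mat_def
    by (rule rat_in_invariants_divide) (simp add: gs_norm_generic_nonzero idx_less)
qed

section \<open>Separation of orbits\<close>

lemma same_orbit_if_invariants_eq:
  fixes x y :: "('a::field_char_0, 'n::finite) pt"
  assumes square: "\<forall>w :: 'a ^ 'n. \<exists>c. c ^ 2 = bil w w"
    and x: "x \<in> generic_pts" and y: "y \<in> generic_pts" and inv: "\<forall>f\<in>invariants_I. f x = f y"
  shows "\<exists>A\<in>orth_group. act A x = y"
proof -
  obtain e where ex: "sqrt_norms x e"
    using sqrt_norms_exists[OF square] by blast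
  have ey: "sqrt_norms y e"
    using ex rat_in_invariants_eq[OF rat_in_invariants_gs_norm[OF idx_less] x y inv]
    unfolding sqrt_norms_def by simp
  have "normal_form x e = normal_form y e"
    unfolding normal_form_def
    using rat_in_invariants_eq[OF rat_in_invariants_nf_vec x y inv]
      rat_in_invariants_eq[OF rat_in_invariants_nf_mat x y inv] by simp
  then have frames: "act (frame x e) x = act (frame y e) y"
    using act_frame[OF x ex] act_frame[OF y ey] by simp
  have "act (transpose (frame y e) ** frame x e) x = act (transpose (frame y e) ** frame y e) y"
    by (simp add: act_act[symmetric] frames)
  also have "\<dots> = y"
    using orth_group_transpose_mult[OF frame_orth_group[OF y ey]] by simp
  finally have "act (transpose (frame y e) ** frame x e) x = y" .
  moreover have "transpose (frame y e) ** frame x e \<in> orth_group"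
    using frame_orth_group[OF x ex] frame_orth_group[OF y ey] by (intro orth_group_mult orth_group_transpose)
  ultimately show ?thesis by blast
qed

theorem separates_orbits_if_square_norms:
  assumes "\<forall>w :: 'a ^ 'n. \<exists>c. c ^ 2 = bil w w"
  shows "separates_orbits TYPE('a::field_char_0 \<times> 'n::finite)"
  unfolding separates_orbits_def
proof (intro exI conjI ballI)
  show "zariski_open (generic_pts :: ('a, 'n) pt set)"
    by (rule zariski_open_generic_pts)
  show "(generic_pts :: ('a, 'n) pt set) \<noteq> {}"
    using witness_generic_pts by blast
  fix x y :: "('a, 'n) pt"
  assume x: "x \<in> generic_pts" and y: "y \<in> generic_pts"
  show "(\<exists>A\<in>orth_group. act A x = y) \<longleftrightarrow> (\<forall>f\<in>invariants_I. f x = f y)"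
  proof
    assume "\<exists>A\<in>orth_group. act A x = y"
    then show "\<forall>f\<in>invariants_I. f x = f y"
      unfolding invariants_I_def by (auto simp: inv_k_act)
  qed (rule same_orbit_if_invariants_eq[OF assms x y])
qed

section \<open>Generation of the field of invariant rational functions\<close>

definition multilinear_in_roots :: "(('a::field, 'n::finite) pt \<Rightarrow> ('n \<Rightarrow> 'a) \<Rightarrow> 'a) \<Rightarrow> bool" where
  "multilinear_in_roots F \<longleftrightarrow> (\<exists>r. (\<forall>S. rat_in_invariants generic_pts (r S)) \<and>
     (\<forall>x\<in>generic_pts. \<forall>e. sqrt_norms x e \<longrightarrow> F x e = (\<Sum>S\<in>UNIV. r S x * (\<Prod>i\<in>S. e i))))"

lemma multilinear_in_roots_const:
  fixes h :: "('a::field, 'n::finite) pt \<Rightarrow> 'a"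
  assumes "rat_in_invariants generic_pts h"
  shows "multilinear_in_roots (\<lambda>x e. h x)"
proof -
  have "rat_in_invariants generic_pts (\<lambda>x. if S = {} then h x else 0)" for S :: "'n set"
    by (cases "S = {}") (simp_all add: assms rat_in_invariants_const)
  then show ?thesis
    unfolding multilinear_in_roots_def
    by (intro exI[of _ "\<lambda>S x. if S = {} then h x else 0"])
       (simp add: if_distrib[of "\<lambda>c. c * _"] cong: if_cong)
qed

lemma multilinear_in_roots_root: "multilinear_in_roots (\<lambda>x e. e i)"
  unfolding multilinear_in_roots_def
  by (rule exI[of _ "\<lambda>S x. if S = {i} then 1 else 0"])
     (auto simp: rat_in_invariants_const if_distrib[of "\<lambda>c. c * _"] cong: if_cong)

lemma multilinear_in_roots_add:
  assumes "multilinear_in_roots F" "multilinear_in_roots G"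
  shows "multilinear_in_roots (\<lambda>x e. F x e + G x e)"
proof -
  obtain r r' where "\<forall>S. rat_in_invariants generic_pts (r S)" "\<forall>S. rat_in_invariants generic_pts (r' S)"
    "\<forall>x\<in>generic_pts. \<forall>e. sqrt_norms x e \<longrightarrow> F x e = (\<Sum>S\<in>UNIV. r S x * (\<Prod>i\<in>S. e i))"
    "\<forall>x\<in>generic_pts. \<forall>e. sqrt_norms x e \<longrightarrow> G x e = (\<Sum>S\<in>UNIV. r' S x * (\<Prod>i\<in>S. e i))"
    using assms unfolding multilinear_in_roots_def by meson
  then show ?thesis
    unfolding multilinear_in_roots_def
    by (intro exI[of _ "\<lambda>S x. r S x + r' S x"]) (simp add: rat_in_invariants_add distrib_right sum.distrib)
qed

text \<open>Products are reduced with \<open>e\<^sub>i\<^sup>2 = \<langle>y\<^sub>i, y\<^sub>i\<rangle>\<close>, which is rational in the invariants.\<close>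

lemma multilinear_in_roots_mult:
  fixes F G :: "('a::field_char_0, 'n::finite) pt \<Rightarrow> ('n \<Rightarrow> 'a) \<Rightarrow> 'a"
  assumes "multilinear_in_roots F" "multilinear_in_roots G"
  shows "multilinear_in_roots (\<lambda>x e. F x e * G x e)"
proof -
  obtain r r' where r: "\<forall>S. rat_in_invariants generic_pts (r S)" "\<forall>S. rat_in_invariants generic_pts (r' S)"
    and F: "\<forall>x\<in>generic_pts. \<forall>e. sqrt_norms x e \<longrightarrow> F x e = (\<Sum>S\<in>UNIV. r S x * (\<Prod>i\<in>S. e i))"
    and G: "\<forall>x\<in>generic_pts. \<forall>e. sqrt_norms x e \<longrightarrow> G x e = (\<Sum>S\<in>UNIV. r' S x * (\<Prod>i\<in>S. e i))"
    using assms unfolding multilinear_in_roots_def by meson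
  define d :: "'n set \<Rightarrow> 'n set \<Rightarrow> 'n set" where "d S T = (S - T) \<union> (T - S)" for S T
  have d_d: "d S (d S R) = R" for S R
    unfolding d_def by auto
  define \<rho> where "\<rho> R x = (\<Sum>S\<in>UNIV. r S x * r' (d S R) x * (\<Prod>i\<in>S \<inter> d S R. gs_norm x (idx i)))" for R x
  have "rat_in_invariants generic_pts (\<rho> R)" for R
    unfolding \<rho>_def using r
    by (intro rat_in_invariants_sum rat_in_invariants_mult rat_in_invariants_prod rat_in_invariants_gs_norm
        idx_less) auto
  moreover have "F x e * G x e = (\<Sum>R\<in>UNIV. \<rho> R x * (\<Prod>i\<in>R. e i))"
    if x: "x \<in> generic_pts" and e: "sqrt_norms x e" for x e
  proof -
    have ee: "e i * e i = gs_norm x (idx i)" for i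
      using e unfolding sqrt_norms_def by (simp add: power2_eq_square)
    have "F x e * G x e = (\<Sum>S\<in>UNIV. r S x * (\<Prod>i\<in>S. e i)) * (\<Sum>T\<in>UNIV. r' T x * (\<Prod>i\<in>T. e i))"
      using F G x e by simp
    also have "\<dots> = (\<Sum>S\<in>UNIV. \<Sum>T\<in>UNIV. r S x * r' T x * ((\<Prod>i\<in>S. e i) * (\<Prod>i\<in>T. e i)))"
      by (subst sum_product) (simp add: mult_ac)
    also have "\<dots> = (\<Sum>S\<in>UNIV. \<Sum>T\<in>UNIV.
        r S x * r' T x * ((\<Prod>i\<in>d S T. e i) * (\<Prod>i\<in>S \<inter> T. gs_norm x (idx i))))"
      by (simp add: prod_mult_prod_sym_diff d_def ee)
    also have "\<dots> = (\<Sum>S\<in>UNIV. \<Sum>R\<in>UNIV.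
        r S x * r' (d S R) x * ((\<Prod>i\<in>R. e i) * (\<Prod>i\<in>S \<inter> d S R. gs_norm x (idx i))))"
    proof (rule sum.cong[OF refl])
      fix S
      show "(\<Sum>T\<in>UNIV. r S x * r' T x * ((\<Prod>i\<in>d S T. e i) * (\<Prod>i\<in>S \<inter> T. gs_norm x (idx i))))
        = (\<Sum>R\<in>UNIV. r S x * r' (d S R) x * ((\<Prod>i\<in>R. e i) * (\<Prod>i\<in>S \<inter> d S R. gs_norm x (idx i))))"
        by (rule sum.reindex_bij_witness[of _ "d S" "d S"]) (auto simp: d_d)
    qed
    also have "\<dots> = (\<Sum>R\<in>UNIV. \<rho> R x * (\<Prod>i\<in>R. e i))"
      unfolding \<rho>_def by (subst sum.swap) (simp add: sum_distrib_left sum_distrib_right mult_ac)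
    finally show ?thesis .
  qed
  ultimately show ?thesis
    unfolding multilinear_in_roots_def by (intro exI[of _ \<rho>]) auto
qed

lemma multilinear_in_roots_sum:
  fixes F :: "'b \<Rightarrow> ('a::field_char_0, 'n::finite) pt \<Rightarrow> ('n \<Rightarrow> 'a) \<Rightarrow> 'a"
  shows "finite A \<Longrightarrow> (\<And>k. k \<in> A \<Longrightarrow> multilinear_in_roots (F k)) \<Longrightarrow>
    multilinear_in_roots (\<lambda>x e. \<Sum>k\<in>A. F k x e)"
  by (induction A rule: finite_induct)
     (auto intro: multilinear_in_roots_add multilinear_in_roots_const rat_in_invariants_const)

lemma multilinear_in_roots_poly_funs_normal_form:
  fixes B :: "'a::field_char_0 ^ 'n::finite ^ 'n"
  assumes "g \<in> poly_funs"
  shows "multilinear_in_roots (\<lambda>x e. g (act B (normal_form x e)))"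
  using assms unfolding poly_funs_def
proof (induction rule: polyfuns.induct)
  case (gen f)
  have "multilinear_in_roots (\<lambda>x e. \<Sum>j\<in>UNIV. B $ i $ j * (nf_vec x j * e j))" for i
    by (intro multilinear_in_roots_sum multilinear_in_roots_mult multilinear_in_roots_const
        rat_in_invariants_const rat_in_invariants_nf_vec multilinear_in_roots_root) auto
  moreover have "multilinear_in_roots
      (\<lambda>x e. \<Sum>k\<in>UNIV. (\<Sum>l\<in>UNIV. B $ i $ l * (nf_mat x l k * (e l * e k))) * B $ j $ k)" for i j
    by (intro multilinear_in_roots_sum multilinear_in_roots_mult multilinear_in_roots_const
        rat_in_invariants_const rat_in_invariants_nf_mat multilinear_in_roots_root) auto
  ultimately show ?case
    using gen unfolding coord_funs_def
    by (auto simp: act_def normal_form_def matrix_vector_mult_def matrix_matrix_mult_def transpose_def)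
qed (auto intro: multilinear_in_roots_add multilinear_in_roots_mult multilinear_in_roots_const
    rat_in_invariants_const)

lemma rat_invariant_invariants_I:
  fixes f :: "('a::field, 'n::finite) pt \<Rightarrow> 'a"
  assumes "f \<in> invariants_I"
  shows "rat_invariant f (\<lambda>_. 1)"
proof -
  obtain k where k: "f = inv_k k"
    using assms unfolding invariants_I_def by blast
  have "(\<lambda>_. 1) \<in> (poly_funs :: (('a, 'n) pt \<Rightarrow> 'a) set)"
    unfolding poly_funs_def by (rule polyfuns.const)
  moreover have "\<exists>x\<in>(skew_pts :: ('a, 'n) pt set). (1 :: 'a) \<noteq> 0"
    by (intro bexI[OF _ witness_skew_pts]) simp
  ultimately show ?thesis
    unfolding rat_invariant_def k using inv_k_poly_funs by (simp add: inv_k_act)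
qed

lemma monomial_coeffs_proportional:
  fixes p q :: "('a::field_char_0, 'n::finite) pt \<Rightarrow> 'a"
  assumes square: "\<forall>w :: 'a ^ 'n. \<exists>c. c ^ 2 = bil w w"
    and pq: "rat_invariant p q" and B: "B \<in> orth_group"
    and \<alpha>: "\<And>x e. x \<in> generic_pts \<Longrightarrow> sqrt_norms x e \<Longrightarrow>
      p (act B (normal_form x e)) = (\<Sum>S\<in>UNIV. \<alpha> S x * (\<Prod>i\<in>S. e i))"
    and \<beta>: "\<And>x e. x \<in> generic_pts \<Longrightarrow> sqrt_norms x e \<Longrightarrow>
      q (act B (normal_form x e)) = (\<Sum>S\<in>UNIV. \<beta> S x * (\<Prod>i\<in>S. e i))"
    and x: "x \<in> generic_pts"
  shows "\<alpha> S x * q x = p x * \<beta> S x"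
proof -
  obtain c where c: "sqrt_norms x c"
    using sqrt_norms_exists[OF square] by blast
  have "\<forall>S\<subseteq>UNIV. \<alpha> S x * q x - p x * \<beta> S x = 0"
  proof (rule monomial_coeffs_zero_if_zero_on_signs[where c = c])
    show "\<forall>i\<in>UNIV. c i \<noteq> 0"
      using sqrt_norms_nonzero[OF x c] by blast
    show "\<forall>e. (\<forall>i\<in>UNIV. e i = c i \<or> e i = - c i) \<longrightarrow>
        (\<Sum>S\<in>Pow UNIV. (\<alpha> S x * q x - p x * \<beta> S x) * (\<Prod>i\<in>S. e i)) = 0"
    proof (intro allI impI)
      fix e assume "\<forall>i\<in>UNIV. e i = c i \<or> e i = - c i"
      then have e: "sqrt_norms x e"
        using sqrt_norms_sign_change[OF c] by blast
      have "B ** frame x e \<in> orth_group"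
        by (rule orth_group_mult[OF frame_orth_group[OF x e] B])
      then have "p (act (B ** frame x e) x) * q x = p x * q (act (B ** frame x e) x)"
        using pq x generic_pts_subset_skew_pts unfolding rat_invariant_def by blast
      then have invariance: "(\<Sum>S\<in>UNIV. \<alpha> S x * (\<Prod>i\<in>S. e i)) * q x
          = p x * (\<Sum>S\<in>UNIV. \<beta> S x * (\<Prod>i\<in>S. e i))"
        by (simp add: \<alpha>[OF x e, symmetric] \<beta>[OF x e, symmetric] act_frame[OF x e, symmetric] act_act)
      have "(\<Sum>S\<in>Pow UNIV. (\<alpha> S x * q x - p x * \<beta> S x) * (\<Prod>i\<in>S. e i))
          = (\<Sum>S\<in>UNIV. \<alpha> S x * (\<Prod>i\<in>S. e i)) * q x - p x * (\<Sum>S\<in>UNIV. \<beta> S x * (\<Prod>i\<in>S. e i))"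
        by (simp add: sum_distrib_left sum_distrib_right sum_subtractf algebra_simps)
      then show "(\<Sum>S\<in>Pow UNIV. (\<alpha> S x * q x - p x * \<beta> S x) * (\<Prod>i\<in>S. e i)) = 0"
        using invariance by simp
    qed
  qed simp
  then show ?thesis by simp
qed

lemma in_generated_field_if_proportional:
  fixes p q a b :: "('a::field_char_0, 'n::finite) pt \<Rightarrow> 'a"
  assumes a: "rat_in_invariants generic_pts a" and b: "rat_in_invariants generic_pts b"
    and x0: "x0 \<in> generic_pts" "b x0 \<noteq> 0"
    and proportional: "\<And>x. x \<in> generic_pts \<Longrightarrow> a x * q x = p x * b x"
  shows "in_generated_field p q"
proof -
  obtain G where G: "G \<in> polyfuns invariants_I" "(generic_pts :: ('a, 'n) pt set) = {x\<in>skew_pts. G x \<noteq> 0}"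
    using generic_pts_eq_nonzero_set by blast
  obtain Pa Qa where Pa: "Pa \<in> polyfuns invariants_I" "Qa \<in> polyfuns invariants_I"
    and a_eq: "\<And>x :: ('a, 'n) pt. x \<in> generic_pts \<Longrightarrow> Qa x \<noteq> 0 \<and> a x = Pa x / Qa x"
    using a by (elim rat_in_invariantsE) blast
  obtain Pb Qb where Pb: "Pb \<in> polyfuns invariants_I" "Qb \<in> polyfuns invariants_I"
    and b_eq: "\<And>x :: ('a, 'n) pt. x \<in> generic_pts \<Longrightarrow> Qb x \<noteq> 0 \<and> b x = Pb x / Qb x"
    using b by (elim rat_in_invariantsE) blast
  have P: "(\<lambda>x. Pa x * Qb x * G x) \<in> polyfuns invariants_I"
    and Q: "(\<lambda>x. Pb x * Qa x * G x) \<in> polyfuns invariants_I"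
    using Pa Pb G(1) by (auto intro: polyfuns.mult)
  show ?thesis
    unfolding in_generated_field_def
  proof (rule bexI[OF _ P], rule bexI[OF _ Q], intro conjI ballI)
    show "\<exists>x\<in>skew_pts. Pb x * Qa x * G x \<noteq> 0"
      using x0 a_eq b_eq G(2) by (intro bexI[of _ x0]) auto
  next
    fix x :: "('a, 'n) pt"
    assume "x \<in> skew_pts"
    show "p x * (Pb x * Qa x * G x) = q x * (Pa x * Qb x * G x)"
    proof (cases "G x = 0")
      case False
      then have x: "x \<in> generic_pts"
        using \<open>x \<in> skew_pts\<close> G(2) by blast
      then have "Pa x / Qa x * q x = p x * (Pb x / Qb x)"
        using proportional a_eq b_eq by simp
      then show ?thesis
        using a_eq[OF x] b_eq[OF x] by (simp add: field_simps)
    qed simp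
  qed
qed

theorem generates_invariant_field_if_square_norms:
  assumes square: "\<forall>w :: 'a ^ 'n. \<exists>c. c ^ 2 = bil w w"
  shows "generates_invariant_field TYPE('a::field_char_0 \<times> 'n::finite)"
  unfolding generates_invariant_field_def
proof (intro conjI ballI allI impI)
  fix f :: "('a, 'n) pt \<Rightarrow> 'a"
  assume "f \<in> invariants_I"
  then show "rat_invariant f (\<lambda>_. 1)"
    by (rule rat_invariant_invariants_I)
next
  fix p q :: "('a, 'n) pt \<Rightarrow> 'a"
  assume pq: "rat_invariant p q"
  then obtain x0 where x0: "x0 \<in> generic_pts" "q x0 \<noteq> 0"
    unfolding rat_invariant_def by (metis nonzero_at_generic_pt)
  obtain e0 where e0: "sqrt_norms x0 e0"
    using sqrt_norms_exists[OF square] by blast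
  \<comment> \<open>\<open>B\<close> moves the normal form of \<open>x0\<close> back to \<open>x0\<close>, so not all coefficients of \<open>q\<close>
    vanish at \<open>x0\<close>.\<close>
  define B where "B = transpose (frame x0 e0)"
  have B: "B \<in> orth_group"
    unfolding B_def by (intro orth_group_transpose frame_orth_group x0(1) e0)
  have B_x0: "act B (normal_form x0 e0) = x0"
    unfolding B_def act_frame[OF x0(1) e0, symmetric] act_act
    using orth_group_transpose_mult[OF frame_orth_group[OF x0(1) e0]] by simp
  have "multilinear_in_roots (\<lambda>x e. p (act B (normal_form x e)))"
    "multilinear_in_roots (\<lambda>x e. q (act B (normal_form x e)))"
    using pq unfolding rat_invariant_def by (auto intro: multilinear_in_roots_poly_funs_normal_form)
  then obtain \<alpha> \<beta> where \<alpha>: "\<forall>S. rat_in_invariants generic_pts (\<alpha> S)"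
      "\<forall>x\<in>generic_pts. \<forall>e. sqrt_norms x e \<longrightarrow>
        p (act B (normal_form x e)) = (\<Sum>S\<in>UNIV. \<alpha> S x * (\<Prod>i\<in>S. e i))"
    and \<beta>: "\<forall>S. rat_in_invariants generic_pts (\<beta> S)"
      "\<forall>x\<in>generic_pts. \<forall>e. sqrt_norms x e \<longrightarrow>
        q (act B (normal_form x e)) = (\<Sum>S\<in>UNIV. \<beta> S x * (\<Prod>i\<in>S. e i))"
    unfolding multilinear_in_roots_def by blast
  have "(\<Sum>S\<in>UNIV. \<beta> S x0 * (\<Prod>i\<in>S. e0 i)) = q x0"
    using \<beta>(2)[rule_format, OF x0(1) e0] B_x0 by simp
  then have "(\<Sum>S\<in>UNIV. \<beta> S x0 * (\<Prod>i\<in>S. e0 i)) \<noteq> 0"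
    using x0(2) by simp
  then obtain T where "\<beta> T x0 \<noteq> 0"
    by (metis (no_types, lifting) mult_eq_0_iff sum.neutral)
  then show "in_generated_field p q"
    using x0(1) \<alpha>(1) \<beta>(1)
      monomial_coeffs_proportional[OF square pq B, of \<alpha> \<beta>] \<alpha>(2) \<beta>(2)
    by (intro in_generated_field_if_proportional[of "\<alpha> T" "\<beta> T" x0]) auto
qed

lemma square_bil_complex: "\<forall>w :: complex ^ 'n::finite. \<exists>c. c ^ 2 = bil w w"
  using power2_csqrt by blast

lemma square_bil_real: "\<forall>w :: real ^ 'n::finite. \<exists>c. c ^ 2 = bil w w"
proof
  fix w :: "real ^ 'n"
  have "bil w w \<ge> 0"
    unfolding bil_def by (intro sum_nonneg) simp
  then show "\<exists>c. c ^ 2 = bil w w"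
    using real_sqrt_pow2 by blast
qed

theorem proposition3p17:
  assumes "CARD('n::finite) \<ge> 2"
  shows "generates_invariant_field TYPE(complex \<times> 'n) \<and>
         generates_invariant_field TYPE(real \<times> 'n) \<and>
         separates_orbits TYPE(complex \<times> 'n) \<and>
         separates_orbits TYPE(real \<times> 'n)"
  using generates_invariant_field_if_square_norms[OF square_bil_complex]
    generates_invariant_field_if_square_norms[OF square_bil_real]
    separates_orbits_if_square_norms[OF square_bil_complex]
    separates_orbits_if_square_norms[OF square_bil_real] by blast

end
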